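(* Let $n\ge1$ and $k\ge0$ be integers. Then $$P_{q,\theta}\big(L_n^{(1)}\le k\big)=\sum_{y=\lfloor n/(k+1)\rfloor}^{n}\theta^{n-y}\prod_{j=1}^{y}(1-\theta q^{j-1})\,V_q(y+1,n-y,k).$$
   Context: Model: fix reals $0\le\theta\le1$ and $0<q<1$. $(X_j)_{j\ge1}$ is a sequence of $\{0,1\}$-valued random variables (1 = success, 0 = failure) with law $P_{q,\theta}$ such that, conditionally on $X_1,\dots,X_{j-1}$ containing exactly $i-1$ zeros, $X_j=0$ with probability $1-\theta q^{i-1}$ and $X_j=1$ with probability $\theta q^{i-1}$. Conventions: $0^0=1$, empty products are 1, empty sums are 0. $L_n^{(1)}$ is the length of the longest run of consecutive successes in $X_1,\dots,X_n$ ($0$ if there is none). For integers $r\ge1$, $s$, and $k\ge0$, $V_q(r,s,k)=\sum q^{x_2+2x_3+\dots+(r-1)x_r}$, the sum being over all integers $x_1,\dots,x_r$ with $0\le x_j\le k$ and $x_1+\dots+x_r=s$. *)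

theory Defs
  imports "HOL-Probability.Probability"
begin

text \<open>
  The sequence is indexed from 1; \<open>X 0\<close> is irrelevant. Conditioning is on the whole history
  \<open>X\<^sub>1 = x\<^sub>1, \<dots>, X\<^sub>j\<^sub>-\<^sub>1 = x\<^sub>j\<^sub>-\<^sub>1\<close>, of which the
  conditional law of \<open>X\<^sub>j\<close> only uses the number \<open>i - 1\<close> of zeros. Histories of probability
  zero are excluded, since \<^const>\<open>cond_prob\<close> is a quotient and takes the value 0 there.
\<close>

locale q_bernoulli_sequence = prob_space M
  for M :: "'a measure" and q \<theta> :: real and X :: "nat \<Rightarrow> 'a \<Rightarrow> nat" +
  assumes X_measurable: "\<And>j. j \<ge> 1 \<Longrightarrow> X j \<in> M \<rightarrow>\<^sub>M count_space {0, 1}"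
    and failure_prob:
      "\<And>j i x. j \<ge> 1 \<Longrightarrow> i \<ge> 1 \<Longrightarrow> card {m \<in> {1..<j}. x m = 0} = i - 1 \<Longrightarrow>
        \<P>(\<omega> in M. \<forall>m\<in>{1..<j}. X m \<omega> = x m) > 0 \<Longrightarrow>
        \<P>(\<omega> in M. X j \<omega> = 0 \<bar> \<forall>m\<in>{1..<j}. X m \<omega> = x m) = 1 - \<theta> * q ^ (i - 1)"
    and success_prob:
      "\<And>j i x. j \<ge> 1 \<Longrightarrow> i \<ge> 1 \<Longrightarrow> card {m \<in> {1..<j}. x m = 0} = i - 1 \<Longrightarrow>
        \<P>(\<omega> in M. \<forall>m\<in>{1..<j}. X m \<omega> = x m) > 0 \<Longrightarrow>
        \<P>(\<omega> in M. X j \<omega> = 1 \<bar> \<forall>m\<in>{1..<j}. X m \<omega> = x m) = \<theta> * q ^ (i - 1)"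

text \<open>The block of length \<open>l = 0\<close> is always admitted, so the maximum is 0 if there is no success.\<close>

definition longest_success_run :: "(nat \<Rightarrow> nat) \<Rightarrow> nat \<Rightarrow> nat" where
  "longest_success_run x n = Max {l. \<exists>a. a + l \<le> n \<and> (\<forall>m\<in>{a+1..a+l}. x m = 1)}"

text \<open>Extensional functions on \<open>{1..r}\<close> represent the tuples \<open>(x\<^sub>1, \<dots>, x\<^sub>r)\<close>.\<close>

definition V :: "real \<Rightarrow> nat \<Rightarrow> int \<Rightarrow> nat \<Rightarrow> real" where
  "V q r s k =
    (\<Sum>x\<in>{x \<in> {1..r} \<rightarrow>\<^sub>E {0..k}. int (\<Sum>j=1..r. x j) = s}. q ^ (\<Sum>j=1..r. (j - 1) * x j))"

end

theory Submission
  imports Defs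
begin

text \<open>
  Split the event that no success run is longer than \<open>k\<close> according to the number \<open>y\<close> of failures
  among the first \<open>n\<close> trials. If \<open>y > 0\<close>, the last failure is followed by some \<open>l \<le> k\<close> successes
  up to time \<open>n\<close>, and what comes before it is an event of the same kind with \<open>n - l - 1\<close> trials
  and \<open>y - 1\<close> failures. Only the number of earlier failures influences the next trial, so this last
  failure costs a factor \<open>1 - \<theta> q\<^bsup>y-1\<^esup>\<close> and each success after it a factor \<open>\<theta> q\<^bsup>y\<^esup>\<close>, whatever
  the history. Hence the probability \<open>A y n\<close> of having \<open>y\<close> failures and no success run longer than
  \<open>k\<close> satisfies, for \<open>y > 0\<close>,
  \<open>A y n = (\<Sum>l\<le>k. A (y - 1) (n - l - 1) * (1 - \<theta> q\<^bsup>y-1\<^esup>) * (\<theta> q\<^bsup>y\<^esup>)\<^bsup>l\<^esup>)\<close>,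
  where terms with \<open>l \<ge> n\<close> are omitted (lemma \<open>prob_runs_Suc_zeros\<close>).

  Splitting off the last summand \<open>x\<^sub>r = l\<close> of a tuple gives
  \<open>V q r s k = (\<Sum>l\<le>k. q\<^bsup>(r-1)l\<^esup> * V q (r - 1) (s - l) k)\<close> for \<open>r > 0\<close> (lemma \<open>V_Suc\<close>). With
  \<open>r = y + 1\<close> and \<open>s = n - y\<close> this is the same recursion, up to the powers of \<open>\<theta>\<close> and the failure
  factors, so induction on \<open>y\<close> identifies \<open>A y n\<close> with the \<open>y\<close>-th summand of the formula (lemma
  \<open>prob_runs_and_zeros\<close>). The sum may start at \<open>n div (k + 1)\<close> because fewer failures leave more
  than \<open>(y + 1) k\<close> successes to be placed in \<open>y + 1\<close> gaps of capacity \<open>k\<close>.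
\<close>

section \<open>Success runs and the last failure\<close>

definition zeros :: "(nat \<Rightarrow> nat) \<Rightarrow> nat \<Rightarrow> nat" where
  "zeros x n = card {m \<in> {1..n}. x m = 0}"

text \<open>A run longer than \<open>k\<close> contains a window of exactly \<open>k + 1\<close> successes.\<close>

definition runs_at_most :: "nat \<Rightarrow> (nat \<Rightarrow> nat) \<Rightarrow> nat \<Rightarrow> bool" where
  "runs_at_most k x n \<longleftrightarrow> (\<forall>a. a + k < n \<longrightarrow> (\<exists>m\<in>{a+1..a+k+1}. x m \<noteq> 1))"

definition depends_on_first :: "nat \<Rightarrow> ((nat \<Rightarrow> nat) \<Rightarrow> bool) \<Rightarrow> bool" where
  "depends_on_first m Q \<longleftrightarrow> (\<forall>x x'. (\<forall>j\<in>{1..m}. x j = x' j) \<longrightarrow> Q x \<longrightarrow> Q x')"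

lemma zeros_0 [simp]: "zeros x 0 = 0"
  by (simp add: zeros_def)

lemma zeros_Suc: "zeros x (Suc n) = zeros x n + (if x (Suc n) = 0 then 1 else 0)"
proof -
  have "{m \<in> {1..Suc n}. x m = 0} =
      (if x (Suc n) = 0 then insert (Suc n) {m \<in> {1..n}. x m = 0} else {m \<in> {1..n}. x m = 0})"
    by (auto simp: le_Suc_eq)
  then show ?thesis
    by (simp add: zeros_def)
qed

lemma zeros_le: "zeros x n \<le> n"
  by (induction n) (auto simp: zeros_Suc)

lemma zeros_cong: "(\<And>j. j \<in> {1..n} \<Longrightarrow> x j = x' j) \<Longrightarrow> zeros x n = zeros x' n"
  unfolding zeros_def by (rule arg_cong[where f = card]) auto

lemma zeros_eq_0_iff: "zeros x n = 0 \<longleftrightarrow> (\<forall>j\<in>{1..n}. x j \<noteq> 0)"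
  by (auto simp: zeros_def)

lemma zeros_add_successes: "(\<forall>j\<in>{m+1..m+l}. x j = 1) \<Longrightarrow> zeros x (m + l) = zeros x m"
  by (induction l) (auto simp: zeros_Suc)

lemma runs_at_most_cong:
  assumes "\<And>j. j \<in> {1..n} \<Longrightarrow> x j = x' j"
  shows "runs_at_most k x n \<longleftrightarrow> runs_at_most k x' n"
proof -
  have "x m = x' m" if "a + k < n" "m \<in> {a+1..a+k+1}" for a m
    using that by (intro assms) auto
  then show ?thesis
    unfolding runs_at_most_def by (metis (no_types, lifting))
qed

lemma longest_success_run_le_iff: "longest_success_run x n \<le> k \<longleftrightarrow> runs_at_most k x n"
proof -
  let ?S = "{l. \<exists>a. a + l \<le> n \<and> (\<forall>m\<in>{a+1..a+l}. x m = 1)}"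
  have fin: "finite ?S"
    by (rule finite_subset[of _ "{..n}"]) auto
  have "0 \<in> ?S"
    by (auto intro: exI[of _ 0])
  then have ne: "?S \<noteq> {}"
    by blast
  have "longest_success_run x n \<le> k \<longleftrightarrow> (\<forall>l\<in>?S. l \<le> k)"
    unfolding longest_success_run_def using fin ne by (rule Max_le_iff)
  also have "\<dots> \<longleftrightarrow> Suc k \<notin> ?S"
  proof
    assume not_in: "Suc k \<notin> ?S"
    show "\<forall>l\<in>?S. l \<le> k"
    proof (intro ballI leI notI)
      fix l assume "l \<in> ?S" and "k < l"
      then obtain a where a: "a + l \<le> n" "\<forall>m\<in>{a+1..a+l}. x m = 1"
        by blast
      have "a + Suc k \<le> n \<and> (\<forall>m\<in>{a+1..a+Suc k}. x m = 1)"
        using a \<open>k < l\<close> by auto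
      with not_in show False
        by blast
    qed
  next
    assume "\<forall>l\<in>?S. l \<le> k"
    then show "Suc k \<notin> ?S"
      by (meson Suc_n_not_le_n)
  qed
  also have "\<dots> \<longleftrightarrow> runs_at_most k x n"
    unfolding runs_at_most_def by (auto simp: Suc_le_eq)
  finally show ?thesis .
qed

text \<open>
  Here \<open>l\<close> is the number of successes after the last zero, which is at position \<open>n - l\<close>. Conversely,
  a window of \<open>k + 1\<close> positions within \<open>{1..n}\<close> either lies before that zero or contains it, because
  fewer than \<open>k + 1\<close> positions follow it.
\<close>

lemma last_zero_decomposition:
  assumes binary: "\<And>j. 1 \<le> j \<Longrightarrow> x j \<in> {0, 1}"
  shows "runs_at_most k x n \<and> zeros x n = Suc y \<longleftrightarrow>
    (\<exists>l\<in>{l. l \<le> k \<and> l < n}. (runs_at_most k x (n - Suc l) \<and> zeros x (n - Suc l) = y) \<and>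
      x (n - l) = 0 \<and> (\<forall>j\<in>{n-l+1..n}. x j = 1))"
    (is "?L \<longleftrightarrow> ?R")
proof
  assume L: ?L
  let ?Z = "{j \<in> {1..n}. x j = 0}"
  have "?Z \<noteq> {}"
  proof
    assume "?Z = {}"
    then have "card ?Z = 0"
      by simp
    with L show False
      by (simp add: zeros_def)
  qed
  then have mem: "Max ?Z \<in> ?Z"
    by (intro Max_in) auto
  define l where "l = n - Max ?Z"
  have l: "l < n" "n - l = Max ?Z" "x (n - l) = 0"
    using mem by (auto simp: l_def)
  have ones: "x j = 1" if "j \<in> {n-l+1..n}" for j
  proof (rule ccontr)
    assume "x j \<noteq> 1"
    then have "j \<in> ?Z"
      using that binary[of j] by auto
    then have "j \<le> Max ?Z"
      by (intro Max_ge) auto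
    with that l show False
      by simp
  qed
  have "l \<le> k"
  proof (rule ccontr)
    assume "\<not> l \<le> k"
    then have "(n - l) + k < n"
      using l by simp
    then obtain m where "m \<in> {n-l+1..n-l+k+1}" "x m \<noteq> 1"
      using L unfolding runs_at_most_def by blast
    then show False
      using ones[of m] \<open>n - l + k < n\<close> by auto
  qed
  moreover have "runs_at_most k x (n - Suc l)"
    using L unfolding runs_at_most_def by auto
  moreover have "zeros x (n - Suc l) = y"
  proof -
    have "n - l + l = n"
      using l(1) by simp
    then have "zeros x n = zeros x (n - l)"
      using zeros_add_successes[of "n - l" l x] ones by metis
    also have "\<dots> = Suc (zeros x (n - Suc l))"
      using zeros_Suc[of x "n - Suc l"] l by (simp add: Suc_diff_Suc)
    finally show ?thesis
      using L by simp
  qed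
  ultimately show ?R
    using l(1,3) ones by (intro bexI[of _ l] conjI ballI CollectI)
next
  assume ?R
  then obtain l where l: "l \<le> k" "l < n" "runs_at_most k x (n - Suc l)" "zeros x (n - Suc l) = y"
      "x (n - l) = 0" and ones: "\<forall>j\<in>{n-l+1..n}. x j = 1"
    by (elim bexE conjE CollectE)
  have "n - l + l = n"
    using l(2) by simp
  then have "zeros x n = zeros x (n - l)"
    using zeros_add_successes[of "n - l" l x] ones by metis
  also have "\<dots> = Suc y"
    using zeros_Suc[of x "n - Suc l"] l by (simp add: Suc_diff_Suc)
  finally have "zeros x n = Suc y" .
  moreover have "runs_at_most k x n"
    unfolding runs_at_most_def
  proof (intro allI impI)
    fix a assume a: "a + k < n"
    show "\<exists>m\<in>{a+1..a+k+1}. x m \<noteq> 1"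
    proof (cases "a + k < n - Suc l")
      case True
      then show ?thesis
        using l(3) unfolding runs_at_most_def by blast
    next
      case False
      then have "n - l \<in> {a+1..a+k+1}"
        using a l by auto
      with l(5) show ?thesis
        by (intro bexI[of _ "n - l"]) auto
    qed
  qed
  ultimately show ?L
    by blast
qed

section \<open>A recursion for the weighted tuple sums\<close>

lemma V_0: "V q 0 s k = (if s = 0 then 1 else 0)"
  by (simp add: V_def)

lemma V_eq_sum_if:
  "V q r s k = (\<Sum>x\<in>{1..r} \<rightarrow>\<^sub>E {0..k}.
     if int (\<Sum>j=1..r. x j) = s then q ^ (\<Sum>j=1..r. (j - 1) * x j) else 0)"
  unfolding V_def by (rule sum.inter_filter) (auto intro: finite_PiE)

text \<open>
  The tuples of length \<open>r + 1\<close> are classified by their last entry \<open>l\<close>, which carries the weight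
  \<open>q\<^bsup>r l\<^esup>\<close>. This is the algebraic counterpart of splitting a sequence of trials at its last zero.
\<close>

lemma V_Suc: "V q (Suc r) s k = (\<Sum>l\<le>k. q ^ (r * l) * V q r (s - int l) k)"
proof -
  let ?f = "\<lambda>r s x. if int (\<Sum>j=1..r. x j) = s then q ^ (\<Sum>j=1..r. (j - 1) * x j) else 0"
  let ?P = "{1..r} \<rightarrow>\<^sub>E {0..k}"
  have ins: "{1..Suc r} = insert (Suc r) {1..r}"
    by auto
  have PiE_eq: "{1..Suc r} \<rightarrow>\<^sub>E {0..k} = (\<lambda>(l, x). x(Suc r := l)) ` ({0..k} \<times> ?P)"
    unfolding ins by (rule PiE_insert_eq)
  have inj: "inj_on (\<lambda>(l, x). x(Suc r := l)) ({0..k} \<times> ?P)"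
    by (rule inj_combinator) simp
  have step: "?f (Suc r) s (x(Suc r := l)) = q ^ (r * l) * ?f r (s - int l) x" for x l
  proof -
    have "(\<Sum>j=1..r. (x(Suc r := l)) j) = (\<Sum>j=1..r. x j)"
        "(\<Sum>j=1..r. (j - 1) * (x(Suc r := l)) j) = (\<Sum>j=1..r. (j - 1) * x j)"
      by (auto intro!: sum.cong)
    then have "(\<Sum>j=1..Suc r. (x(Suc r := l)) j) = (\<Sum>j=1..r. x j) + l"
        "(\<Sum>j=1..Suc r. (j - 1) * (x(Suc r := l)) j) = (\<Sum>j=1..r. (j - 1) * x j) + r * l"
      by simp_all
    then show ?thesis
      by (auto simp: power_add)
  qed
  have "V q (Suc r) s k = (\<Sum>x\<in>{1..Suc r} \<rightarrow>\<^sub>E {0..k}. ?f (Suc r) s x)"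
    by (rule V_eq_sum_if)
  also have "\<dots> = (\<Sum>(l, x)\<in>{0..k} \<times> ?P. ?f (Suc r) s (x(Suc r := l)))"
    unfolding PiE_eq sum.reindex[OF inj] by (simp add: case_prod_unfold o_def)
  also have "\<dots> = (\<Sum>l\<in>{0..k}. \<Sum>x\<in>?P. q ^ (r * l) * ?f r (s - int l) x)"
    unfolding step by (simp add: sum.cartesian_product)
  also have "\<dots> = (\<Sum>l\<le>k. q ^ (r * l) * V q r (s - int l) k)"
    unfolding V_eq_sum_if sum_distrib_left atLeast0AtMost ..
  finally show ?thesis .
qed

lemma V_eq_0:
  assumes "s < 0 \<or> int (r * k) < s"
  shows "V q r s k = 0"
proof -
  have "int (\<Sum>j=1..r. x j) \<noteq> s" if "x \<in> {1..r} \<rightarrow>\<^sub>E {0..k}" for x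
  proof -
    have "(\<Sum>j=1..r. x j) \<le> (\<Sum>j=1..r. k)"
      using that by (intro sum_mono) (auto simp: PiE_iff)
    then have "(\<Sum>j=1..r. x j) \<le> r * k"
      by simp
    then show ?thesis
      using assms by linarith
  qed
  then show ?thesis
    by (simp add: V_eq_sum_if)
qed

section \<open>Extending an event by further trials\<close>

context q_bernoulli_sequence
begin

abbreviation trials :: "'a \<Rightarrow> nat \<Rightarrow> nat" where
  "trials \<omega> \<equiv> \<lambda>j. X j \<omega>"

lemma X_binary: "1 \<le> j \<Longrightarrow> \<omega> \<in> space M \<Longrightarrow> X j \<omega> \<in> {0, 1}"
  using X_measurable[of j] by (auto dest: measurable_space)

lemma X_event:
  assumes "1 \<le> j"
  shows "{\<omega> \<in> space M. X j \<omega> = c} \<in> events"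
proof -
  have "{\<omega> \<in> space M. X j \<omega> = c} = X j -` ({c} \<inter> {0, 1}) \<inter> space M"
    using X_binary[OF assms] by auto
  also have "\<dots> \<in> events"
    using X_measurable[OF assms] by (rule measurable_sets) auto
  finally show ?thesis .
qed

lemma history_event: "{\<omega> \<in> space M. \<forall>j\<in>{m..<n}. X j \<omega> = x j} \<in> events" if "1 \<le> m"
  using that by (intro sets.sets_Collect_finite_All X_event) auto

text \<open>
  The trials are binary on the sample space, so an event about the first \<open>m\<close> of them is the disjoint
  union of finitely many histories.
\<close>

lemma sum_over_histories:
  assumes Q: "depends_on_first m Q" and E: "E \<in> events"
  shows "{\<omega> \<in> space M. Q (trials \<omega>) \<and> \<omega> \<in> E} \<in> events" (is ?meas)
    and "\<P>(\<omega> in M. Q (trials \<omega>) \<and> \<omega> \<in> E) =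
      (\<Sum>x\<in>{x \<in> {1..m} \<rightarrow>\<^sub>E {0, 1}. Q x}.
        \<P>(\<omega> in M. \<omega> \<in> E \<and> (\<forall>j\<in>{1..<Suc m}. X j \<omega> = x j)))" (is ?sum)
proof -
  let ?H = "{x \<in> {1..m} \<rightarrow>\<^sub>E {0, 1}. Q x}"
  let ?C = "\<lambda>x. {\<omega> \<in> space M. \<omega> \<in> E \<and> (\<forall>j\<in>{1..<Suc m}. X j \<omega> = x j)}"
  have fin: "finite ?H"
    by (rule finite_subset[of _ "{1..m} \<rightarrow>\<^sub>E {0, 1}"]) (auto intro: finite_PiE)
  have meas: "?C x \<in> events" for x
  proof -
    have "?C x = E \<inter> {\<omega> \<in> space M. \<forall>j\<in>{1..<Suc m}. X j \<omega> = x j}"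
      by auto
    then show ?thesis
      using E history_event[of 1 "Suc m" x] by auto
  qed
  have union: "{\<omega> \<in> space M. Q (trials \<omega>) \<and> \<omega> \<in> E} = (\<Union>x\<in>?H. ?C x)"
  proof (intro equalityI subsetI)
    fix \<omega> assume \<omega>: "\<omega> \<in> {\<omega> \<in> space M. Q (trials \<omega>) \<and> \<omega> \<in> E}"
    define x where "x = restrict (trials \<omega>) {1..m}"
    have "Q x"
      using Q \<omega> unfolding depends_on_first_def x_def by (metis (mono_tags, lifting) mem_Collect_eq restrict_apply')
    moreover have "x \<in> {1..m} \<rightarrow>\<^sub>E {0, 1}"
      using X_binary \<omega> unfolding x_def by (intro restrict_PiE_iff[THEN iffD2]) auto
    moreover have "\<omega> \<in> ?C x"
      using \<omega> by (auto simp: x_def)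
    ultimately show "\<omega> \<in> (\<Union>x\<in>?H. ?C x)"
      by blast
  next
    fix \<omega> assume "\<omega> \<in> (\<Union>x\<in>?H. ?C x)"
    then obtain x where x: "Q x" "\<omega> \<in> ?C x"
      by blast
    then have "\<forall>j\<in>{1..m}. x j = trials \<omega> j"
      by auto
    then have "Q (trials \<omega>)"
      using Q[unfolded depends_on_first_def, rule_format, of x "trials \<omega>"] x(1) by blast
    with x show "\<omega> \<in> {\<omega> \<in> space M. Q (trials \<omega>) \<and> \<omega> \<in> E}"
      by blast
  qed
  have disj: "disjoint_family_on ?C ?H"
    unfolding disjoint_family_on_def
  proof (intro ballI impI)
    fix x x' assume x: "x \<in> ?H" "x' \<in> ?H" "x \<noteq> x'"
    have "\<exists>j\<in>{1..m}. x j \<noteq> x' j"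
      using x by (metis (no_types, lifting) PiE_ext mem_Collect_eq)
    then show "?C x \<inter> ?C x' = {}"
      by fastforce
  qed
  show ?meas
    unfolding union using fin meas by auto
  show ?sum
    unfolding union using fin meas disj by (intro finite_measure_finite_Union) auto
qed

lemma trials_event:
  assumes "depends_on_first m Q"
  shows "{\<omega> \<in> space M. Q (trials \<omega>)} \<in> events"
proof -
  have "{\<omega> \<in> space M. Q (trials \<omega>)} = {\<omega> \<in> space M. Q (trials \<omega>) \<and> \<omega> \<in> space M}"
    by auto
  then show ?thesis
    using sum_over_histories(1)[OF assms sets.top] by simp
qed

text \<open>
  The model specifies conditional laws given a full history. Given an event about the first \<open>m\<close>
  trials on which the number of failures is constant, all its histories prescribe the same success
  probability, so this common factor can be pulled out of the sum over histories. Histories of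
  probability zero, where the conditional law is unspecified, contribute zero to both sides.
\<close>

lemma next_trial:
  assumes Q: "depends_on_first m Q" and z: "\<And>x. Q x \<Longrightarrow> zeros x m = z"
  shows next_failure: "\<P>(\<omega> in M. Q (trials \<omega>) \<and> X (Suc m) \<omega> = 0) =
      \<P>(\<omega> in M. Q (trials \<omega>)) * (1 - \<theta> * q ^ z)" (is "?fail = _")
    and next_success: "\<P>(\<omega> in M. Q (trials \<omega>) \<and> X (Suc m) \<omega> = 1) =
      \<P>(\<omega> in M. Q (trials \<omega>)) * (\<theta> * q ^ z)" (is "?succ = _")
proof -
  let ?H = "{x \<in> {1..m} \<rightarrow>\<^sub>E {0, 1}. Q x}"
  let ?h = "\<lambda>x \<omega>. \<forall>j\<in>{1..<Suc m}. X j \<omega> = x j"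
  have extend: "\<P>(\<omega> in M. X (Suc m) \<omega> = c \<and> ?h x \<omega>) = \<P>(\<omega> in M. ?h x \<omega>) * p"
    if p: "\<P>(\<omega> in M. ?h x \<omega>) > 0 \<Longrightarrow> \<P>(\<omega> in M. X (Suc m) \<omega> = c \<bar> ?h x \<omega>) = p" for x c p
  proof (cases "\<P>(\<omega> in M. ?h x \<omega>) > 0")
    case True
    with p[OF True] show ?thesis
      by (simp add: cond_prob_def field_simps)
  next
    case False
    then have null: "\<P>(\<omega> in M. ?h x \<omega>) = 0"
      by (simp add: zero_less_measure_iff)
    have "\<P>(\<omega> in M. X (Suc m) \<omega> = c \<and> ?h x \<omega>) \<le> \<P>(\<omega> in M. ?h x \<omega>)"
      using history_event[of 1 "Suc m" x] by (intro finite_measure_mono) auto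
    with null show ?thesis
      by (simp add: measure_le_0_iff)
  qed
  have total: "\<P>(\<omega> in M. Q (trials \<omega>)) = (\<Sum>x\<in>?H. \<P>(\<omega> in M. ?h x \<omega>))"
  proof -
    have "{\<omega> \<in> space M. Q (trials \<omega>)} = {\<omega> \<in> space M. Q (trials \<omega>) \<and> \<omega> \<in> space M}"
      by auto
    moreover have "{\<omega> \<in> space M. ?h x \<omega>} = {\<omega> \<in> space M. \<omega> \<in> space M \<and> ?h x \<omega>}" for x
      by auto
    ultimately show ?thesis
      using sum_over_histories(2)[OF Q sets.top] by simp
  qed
  have *: "\<P>(\<omega> in M. Q (trials \<omega>) \<and> X (Suc m) \<omega> = c) = \<P>(\<omega> in M. Q (trials \<omega>)) * p"
    if p: "\<And>x. x \<in> ?H \<Longrightarrow> \<P>(\<omega> in M. ?h x \<omega>) > 0 \<Longrightarrow>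
      \<P>(\<omega> in M. X (Suc m) \<omega> = c \<bar> ?h x \<omega>) = p" for c p
  proof -
    let ?E = "{\<omega> \<in> space M. X (Suc m) \<omega> = c}"
    have "{\<omega> \<in> space M. Q (trials \<omega>) \<and> X (Suc m) \<omega> = c} = {\<omega> \<in> space M. Q (trials \<omega>) \<and> \<omega> \<in> ?E}"
      by auto
    then have "\<P>(\<omega> in M. Q (trials \<omega>) \<and> X (Suc m) \<omega> = c) =
        (\<Sum>x\<in>?H. \<P>(\<omega> in M. \<omega> \<in> ?E \<and> ?h x \<omega>))"
      using sum_over_histories(2)[OF Q X_event[of "Suc m" c]] by simp
    also have "\<dots> = (\<Sum>x\<in>?H. \<P>(\<omega> in M. X (Suc m) \<omega> = c \<and> ?h x \<omega>))"
      by (intro sum.cong refl arg_cong[where f = "measure M"]) auto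
    also have "\<dots> = (\<Sum>x\<in>?H. \<P>(\<omega> in M. ?h x \<omega>) * p)"
      by (intro sum.cong refl extend p) auto
    finally show ?thesis
      unfolding total sum_distrib_right .
  qed
  have count: "card {j \<in> {1..<Suc m}. x j = 0} = Suc z - 1" if "x \<in> ?H" for x
    using z[of x] that by (simp add: zeros_def atLeastLessThanSuc_atLeastAtMost)
  show "?fail = \<P>(\<omega> in M. Q (trials \<omega>)) * (1 - \<theta> * q ^ z)"
    using failure_prob[of "Suc m" "Suc z", OF _ _ count] by (intro *) simp
  show "?succ = \<P>(\<omega> in M. Q (trials \<omega>)) * (\<theta> * q ^ z)"
    using success_prob[of "Suc m" "Suc z", OF _ _ count] by (intro *) simp
qed

text \<open>Successes leave the number of zeros at \<open>z\<close>, so the same factor recurs in every step.\<close>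

lemma success_block:
  assumes Q: "depends_on_first m Q" and z: "\<And>x. Q x \<Longrightarrow> zeros x m = z"
  shows "\<P>(\<omega> in M. Q (trials \<omega>) \<and> (\<forall>j\<in>{m+1..m+l}. X j \<omega> = 1)) =
    \<P>(\<omega> in M. Q (trials \<omega>)) * (\<theta> * q ^ z) ^ l"
proof (induction l)
  case 0
  then show ?case
    by simp
next
  case (Suc l)
  let ?R = "\<lambda>x. Q x \<and> (\<forall>j\<in>{m+1..m+l}. x j = 1)"
  have dep: "depends_on_first (m + l) ?R"
    using Q unfolding depends_on_first_def by (metis (no_types, opaque_lifting) atLeastAtMost_iff le_add1 le_add2 le_trans trans_le_add1)
  have count: "zeros x (m + l) = z" if "?R x" for x
    using that z zeros_add_successes by auto
  have "{\<omega> \<in> space M. Q (trials \<omega>) \<and> (\<forall>j\<in>{m+1..m+Suc l}. X j \<omega> = 1)} =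
      {\<omega> \<in> space M. ?R (trials \<omega>) \<and> X (Suc (m + l)) \<omega> = 1}"
    by (auto simp: le_Suc_eq)
  then show ?case
    using next_success[OF dep count] Suc.IH by simp
qed

section \<open>Runs and number of failures jointly\<close>

lemma depends_on_first_runs_zeros:
  "depends_on_first n (\<lambda>x. runs_at_most k x n \<and> zeros x n = y)"
  unfolding depends_on_first_def using runs_at_most_cong zeros_cong by metis

lemma prob_runs_no_zeros:
  "\<P>(\<omega> in M. runs_at_most k (trials \<omega>) n \<and> zeros (trials \<omega>) n = 0) = (if n \<le> k then \<theta> ^ n else 0)"
proof -
  have "runs_at_most k (trials \<omega>) n \<and> zeros (trials \<omega>) n = 0 \<longleftrightarrow> n \<le> k \<and> (\<forall>j\<in>{1..n}. X j \<omega> = 1)"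
    if "\<omega> \<in> space M" for \<omega>
  proof -
    have "zeros (trials \<omega>) n = 0 \<longleftrightarrow> (\<forall>j\<in>{1..n}. X j \<omega> = 1)"
      using X_binary[OF _ that] by (force simp: zeros_eq_0_iff)
    moreover have "runs_at_most k (trials \<omega>) n \<longleftrightarrow> n \<le> k" if "\<forall>j\<in>{1..n}. X j \<omega> = 1"
    proof
      assume r: "runs_at_most k (trials \<omega>) n"
      show "n \<le> k"
      proof (rule ccontr)
        assume "\<not> n \<le> k"
        then show False
          using r that unfolding runs_at_most_def by (fastforce dest: spec[of _ 0])
      qed
    qed (auto simp: runs_at_most_def)
    ultimately show ?thesis
      by blast
  qed
  then have "\<P>(\<omega> in M. runs_at_most k (trials \<omega>) n \<and> zeros (trials \<omega>) n = 0) =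
      \<P>(\<omega> in M. n \<le> k \<and> (\<forall>j\<in>{1..n}. X j \<omega> = 1))"
    by (intro arg_cong[where f = "measure M"]) auto
  also have "\<dots> = (if n \<le> k then \<theta> ^ n else 0)"
    using success_block[of 0 "\<lambda>_. True" 0 n] by (simp add: depends_on_first_def prob_space)
  finally show ?thesis .
qed

lemma prob_runs_Suc_zeros:
  "\<P>(\<omega> in M. runs_at_most k (trials \<omega>) n \<and> zeros (trials \<omega>) n = Suc y) =
    (\<Sum>l\<in>{l. l \<le> k \<and> l < n}.
      \<P>(\<omega> in M. runs_at_most k (trials \<omega>) (n - Suc l) \<and> zeros (trials \<omega>) (n - Suc l) = y) *
      (1 - \<theta> * q ^ y) * (\<theta> * q ^ Suc y) ^ l)"
proof -
  let ?I = "{l. l \<le> k \<and> l < n}"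
  let ?B = "\<lambda>l x. (runs_at_most k x (n - Suc l) \<and> zeros x (n - Suc l) = y) \<and> x (n - l) = 0"
  let ?C = "\<lambda>l. {\<omega> \<in> space M. ?B l (trials \<omega>) \<and> (\<forall>j\<in>{n-l+1..n}. X j \<omega> = 1)}"
  have dep: "depends_on_first (n - l) (?B l)" if "l < n" for l
  proof -
    have "?B l x'" if "\<forall>j\<in>{1..n-l}. x j = x' j" "?B l x" for x x'
    proof -
      have "x (n - l) = x' (n - l)" "\<forall>j\<in>{1..n-Suc l}. x j = x' j"
        using that(1) \<open>l < n\<close> by auto
      with that(2) show ?thesis
        using runs_at_most_cong zeros_cong by metis
    qed
    then show ?thesis
      unfolding depends_on_first_def by blast
  qed
  have dep_block: "depends_on_first n (\<lambda>x. ?B l x \<and> (\<forall>j\<in>{n-l+1..n}. x j = 1))" if "l < n" for l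
    unfolding depends_on_first_def
  proof (intro allI impI)
    fix x x' assume agree: "\<forall>j\<in>{1..n}. x j = x' j"
      and x: "?B l x \<and> (\<forall>j\<in>{n-l+1..n}. x j = 1)"
    have "\<forall>j\<in>{1..n-l}. x j = x' j"
      using agree by auto
    then have "?B l x'"
      using dep[OF that, unfolded depends_on_first_def, rule_format, of x x'] x by blast
    moreover have "\<forall>j\<in>{n-l+1..n}. x' j = 1"
      using agree x by auto
    ultimately show "?B l x' \<and> (\<forall>j\<in>{n-l+1..n}. x' j = 1)"
      by blast
  qed
  have split: "{\<omega> \<in> space M. runs_at_most k (trials \<omega>) n \<and> zeros (trials \<omega>) n = Suc y} =
      (\<Union>l\<in>?I. ?C l)"
  proof -
    have "runs_at_most k (trials \<omega>) n \<and> zeros (trials \<omega>) n = Suc y \<longleftrightarrow>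
        (\<exists>l\<in>?I. ?B l (trials \<omega>) \<and> (\<forall>j\<in>{n-l+1..n}. X j \<omega> = 1))" if "\<omega> \<in> space M" for \<omega>
      using last_zero_decomposition[of "trials \<omega>" k n y] X_binary[OF _ that] by auto
    then show ?thesis
      by auto
  qed
  have additive: "measure M (\<Union>l\<in>?I. ?C l) = (\<Sum>l\<in>?I. measure M (?C l))"
  proof (rule finite_measure_finite_Union)
    show "?C ` ?I \<subseteq> events"
      using trials_event[OF dep_block] by auto
    show "disjoint_family_on ?C ?I"
      unfolding disjoint_family_on_def
    proof (intro ballI impI)
      have "?C l \<inter> ?C l' = {}" if "l < l'" "l' < n" for l l'
      proof -
        have "n - l \<in> {n-l'+1..n}"
          using that by auto
        then show ?thesis
          by fastforce
      qed
      then show "?C l \<inter> ?C l' = {}" if "l \<in> ?I" "l' \<in> ?I" "l \<noteq> l'" for l l'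
        using that by (metis (no_types, lifting) Int_commute linorder_neqE_nat mem_Collect_eq)
    qed
  qed auto
  have summand: "measure M (?C l) =
      \<P>(\<omega> in M. runs_at_most k (trials \<omega>) (n - Suc l) \<and> zeros (trials \<omega>) (n - Suc l) = y) *
      (1 - \<theta> * q ^ y) * (\<theta> * q ^ Suc y) ^ l" if "l \<in> ?I" for l
  proof -
    have pred: "Suc (n - Suc l) = n - l" and n: "n - l + l = n"
      using that by auto
    have count: "zeros x (n - l) = Suc y" if "?B l x" for x
      using that zeros_Suc[of x "n - Suc l"] unfolding pred by simp
    have "measure M (?C l) = \<P>(\<omega> in M. ?B l (trials \<omega>)) * (\<theta> * q ^ Suc y) ^ l"
      using success_block[OF dep[of l] count, of l] that unfolding n by simp
    also have "\<P>(\<omega> in M. ?B l (trials \<omega>)) =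
        \<P>(\<omega> in M. runs_at_most k (trials \<omega>) (n - Suc l) \<and> zeros (trials \<omega>) (n - Suc l) = y) *
        (1 - \<theta> * q ^ y)"
      using next_failure[OF depends_on_first_runs_zeros[of "n - Suc l" k y], of y] unfolding pred by simp
    finally show ?thesis .
  qed
  show ?thesis
    unfolding split additive by (intro sum.cong refl summand)
qed

text \<open>
  The exponent \<open>n - y\<close> of \<open>\<theta>\<close> is truncated when \<open>y > n\<close>; this does no harm, since the integer
  \<open>int n - int y\<close> is then negative and \<open>V\<close> vanishes.
\<close>

lemma prob_runs_and_zeros:
  "\<P>(\<omega> in M. runs_at_most k (trials \<omega>) n \<and> zeros (trials \<omega>) n = y) =
    \<theta> ^ (n - y) * (\<Prod>j=1..y. 1 - \<theta> * q ^ (j - 1)) * V q (y + 1) (int n - int y) k"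
proof (induction y arbitrary: n)
  case 0
  have "V q 1 (int n) k = (\<Sum>l\<le>k. if l = n then 1 else 0)"
    by (auto simp: V_Suc V_0 intro!: sum.cong)
  also have "\<dots> = (if n \<le> k then 1 else 0)"
    by simp
  finally show ?case
    by (simp add: prob_runs_no_zeros)
next
  case (Suc y)
  let ?\<Pi> = "\<lambda>y. \<Prod>j=1..y. 1 - \<theta> * q ^ (j - 1)"
  let ?V = "\<lambda>l. V q (Suc y) (int n - int (Suc y) - int l) k"
  have term_eq: "\<P>(\<omega> in M. runs_at_most k (trials \<omega>) (n - Suc l) \<and> zeros (trials \<omega>) (n - Suc l) = y) *
      (1 - \<theta> * q ^ y) * (\<theta> * q ^ Suc y) ^ l =
      \<theta> ^ (n - Suc y) * ?\<Pi> (Suc y) * (q ^ (Suc y * l) * ?V l)" if "l < n" for l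
  proof (cases "Suc y + l \<le> n")
    case True
    have "int (n - Suc l) - int y = int n - int (Suc y) - int l"
      using that by simp
    moreover have "\<theta> ^ (n - Suc y) = \<theta> ^ (n - Suc l - y) * \<theta> ^ l"
      using True by (simp flip: power_add)
    moreover have "(\<theta> * q ^ Suc y) ^ l = \<theta> ^ l * q ^ (Suc y * l)"
      by (simp only: power_mult_distrib power_mult)
    moreover have "?\<Pi> (Suc y) = ?\<Pi> y * (1 - \<theta> * q ^ y)"
      by simp
    ultimately show ?thesis
      unfolding Suc.IH by (simp only: Suc_eq_plus1[symmetric] mult_ac)
  next
    case False
    then have "V q (y + 1) (int (n - Suc l) - int y) k = 0" "?V l = 0"
      using that by (auto intro!: V_eq_0)
    then show ?thesis
      unfolding Suc.IH by simp
  qed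
  have "\<P>(\<omega> in M. runs_at_most k (trials \<omega>) n \<and> zeros (trials \<omega>) n = Suc y) =
      (\<Sum>l\<in>{l. l \<le> k \<and> l < n}. \<theta> ^ (n - Suc y) * ?\<Pi> (Suc y) * (q ^ (Suc y * l) * ?V l))"
    unfolding prob_runs_Suc_zeros by (intro sum.cong refl term_eq) simp
  \<comment> \<open>The summands with \<open>l \<ge> n\<close> vanish, as they ask for tuples with a negative sum.\<close>
  also have "\<dots> = (\<Sum>l\<le>k. \<theta> ^ (n - Suc y) * ?\<Pi> (Suc y) * (q ^ (Suc y * l) * ?V l))"
    by (rule sum.mono_neutral_left) (auto simp: V_eq_0)
  also have "\<dots> = \<theta> ^ (n - Suc y) * ?\<Pi> (Suc y) * V q (Suc y + 1) (int n - int (Suc y)) k"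
    unfolding Suc_eq_plus1[of "Suc y", symmetric] V_Suc[of q "Suc y"] sum_distrib_left ..
  finally show ?case .
qed

lemma prob_runs_at_most:
  "\<P>(\<omega> in M. runs_at_most k (trials \<omega>) n) =
    (\<Sum>y\<le>n. \<P>(\<omega> in M. runs_at_most k (trials \<omega>) n \<and> zeros (trials \<omega>) n = y))"
proof -
  let ?A = "\<lambda>y. {\<omega> \<in> space M. runs_at_most k (trials \<omega>) n \<and> zeros (trials \<omega>) n = y}"
  have split: "{\<omega> \<in> space M. runs_at_most k (trials \<omega>) n} = (\<Union>y\<in>{..n}. ?A y)"
    using zeros_le by auto
  show ?thesis
    unfolding split
  proof (rule finite_measure_finite_Union)
    show "?A ` {..n} \<subseteq> events"
      using trials_event[OF depends_on_first_runs_zeros] by blast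
    show "disjoint_family_on ?A {..n}"
      unfolding disjoint_family_on_def by blast
  qed simp
qed

end

theorem theorem6p2:
  fixes M :: "'a measure" and X :: "nat \<Rightarrow> 'a \<Rightarrow> nat"
    and q \<theta> :: real and n k :: nat
  assumes "0 \<le> \<theta>" and "\<theta> \<le> 1" and "0 < q" and "q < 1"
    and "q_bernoulli_sequence M q \<theta> X"
    and "n \<ge> 1"
  shows "\<P>(\<omega> in M. longest_success_run (\<lambda>j. X j \<omega>) n \<le> k) =
    (\<Sum>y = n div (k + 1)..n.
      \<theta> ^ (n - y) * (\<Prod>j=1..y. 1 - \<theta> * q ^ (j - 1)) * V q (y + 1) (int n - int y) k)"
proof -
  interpret q_bernoulli_sequence M q \<theta> X
    by fact
  let ?t = "\<lambda>y. \<theta> ^ (n - y) * (\<Prod>j=1..y. 1 - \<theta> * q ^ (j - 1)) * V q (y + 1) (int n - int y) k"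
  have "\<P>(\<omega> in M. longest_success_run (\<lambda>j. X j \<omega>) n \<le> k) = (\<Sum>y\<le>n. ?t y)"
    unfolding longest_success_run_le_iff prob_runs_at_most prob_runs_and_zeros ..
  also have "\<dots> = (\<Sum>y = n div (k + 1)..n. ?t y)"
  proof (rule sum.mono_neutral_right)
    show "\<forall>y\<in>{..n} - {n div (k + 1)..n}. ?t y = 0"
    proof
      fix y assume "y \<in> {..n} - {n div (k + 1)..n}"
      then have "y + 1 \<le> n div (k + 1)"
        by auto
      then have "(y + 1) * (k + 1) \<le> n"
        by (simp only: less_eq_div_iff_mult_less_eq zero_less_Suc Suc_eq_plus1[symmetric])
      then have "(y + 1) * k + y < n"
        by (simp add: algebra_simps)
      then have "int ((y + 1) * k) < int n - int y"
        by linarith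
      then show "?t y = 0"
        by (simp add: V_eq_0)
    qed
  qed auto
  finally show ?thesis .
qed

end
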